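(* The K-shell protocol (written out in the context) correctly computes the shell number $shell(v)$ for all $v\in V$, for the input graph $G(V,E)$.
   Context: **Graphs and representation.** $G(V,E)$ is a graph with vertex set $V=\{1,\dots,n\}$ and $m=|E|$ edges; edges are directed (ordered pairs of vertices), an undirected graph being included as a graph with bidirectional edges. The input is given in the edgelist representation $(\mathcal{E},Idx)$. $\mathcal{E}$ is an array of length $m+1$ containing the concatenated adjacency lists of all vertices (in the order $1,2,\dots,n$) and an empty element at the end. $Idx$ is an array of length $n$: $Idx[u]=i$ if out-degree$(u)\neq 0$ and $\mathcal{E}[i]$ is the first neighbour of $u$ in $\mathcal{E}$; $Idx[u]=Idx[u+1]$ if $u\neq n$ and out-degree$(u)=0$; $Idx[u]=m+1$ if $u=n$ and out-degree$(u)=0$. Convention: $Idx[n+1]=m+1$. **Shell numbers.** The $k$-core $G_k$ of $G$ is the subgraph induced by the largest vertex set $V_k\subseteq V$ such that every $v\in V_k$ has degree at least $k$ in $G_k$. The set $shell_i$ consists of the vertices of $G$ that belong to the $i$-core $G_i$ but not to the $(i+1)$-core $G_{i+1}$, and $shell(v)=i$ if $v\in shell_i$. **The K-shell protocol.** Input: $(\mathcal{E},Idx)$. Output: the shell number $shell(v)$ of each $v\in V$, namely the final value $deg[v]$. 1. $deg[i]\leftarrow 0$ for $1\le i\le n$; $vert[i]\leftarrow i$ for $1\le i\le n$; $bin[i]\leftarrow 0$ for $1\le i\le n-1$. 2. For $i=1$ to $n$: $deg[i]\leftarrow Idx[i+1]-Idx[i]$; $bin[deg[i]]\leftarrow bin[deg[i]]+1$.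 3. $start\leftarrow 1$. For $i=1$ to $n$: $temp\leftarrow bin[i]$; $bin[i]\leftarrow start$; $start\leftarrow start+temp$. 4. Sort $vert$ with respect to the degrees $deg$ (by a data-oblivious sorting primitive). Set $pos[vert[i]]\leftarrow i$ for $1\le i\le n$. 5. $i\leftarrow 1$; $v\leftarrow vert[i]$; $j\leftarrow Idx[v]$. 6. For $iter=1$ to $n+m-1$: - If $j==Idx[v+1]$: $i\leftarrow i+1$; $v\leftarrow vert[i]$; $j\leftarrow Idx[v]$. - Else: $u\leftarrow\mathcal{E}[j]$. If $deg[u]>deg[v]$: { $du\leftarrow deg[u]$; $pu\leftarrow pos[u]$; $pw\leftarrow bin[du]$; $w\leftarrow vert[pw]$; if $u\neq w$: { $pos[u]\leftarrow pw$; $vert[pu]\leftarrow w$; $pos[w]\leftarrow pu$; $vert[pw]\leftarrow u$ }; $bin[du]\leftarrow bin[du]+1$; $deg[u]\leftarrow deg[u]-1$ }. Then (still in the else branch) $j\leftarrow j+1$.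
   Formalization: The graph is assumed undirected (every edge bidirectional); the protocol as printed is shown correct only when no vertex has degree 0, and for graphs with isolated vertices it is corrected so that the array bin and the loop of step 3 start at index 0. The claim fails otherwise. *)

theory Defs
  imports "Graph_Theory.Graph_Theory" "HOL-Library.Multiset"
begin

text \<open>
  Edges are ordered pairs. An undirected graph is a symmetric digraph, and there the degree of a
  vertex is its out-degree, that is, the length of its adjacency list (a loop counts once).
\<close>

definition core_verts :: "('a, 'b) pre_digraph \<Rightarrow> nat \<Rightarrow> 'a set" where
  "core_verts G k =
     (GREATEST W. W \<subseteq> verts G \<and> (\<forall>v\<in>W. out_degree (G \<restriction> W) v \<ge> k))"

definition core :: "('a, 'b) pre_digraph \<Rightarrow> nat \<Rightarrow> ('a, 'b) pre_digraph" where
  "core G k = G \<restriction> core_verts G k"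

definition shell_set :: "('a, 'b) pre_digraph \<Rightarrow> nat \<Rightarrow> 'a set" where
  "shell_set G i = verts (core G i) - verts (core G (i + 1))"

definition shell :: "('a, 'b) pre_digraph \<Rightarrow> 'a \<Rightarrow> nat" where
  "shell G v = (THE i. v \<in> shell_set G i)"

text \<open>
  All arrays are functions on \<^typ>\<open>nat\<close> that are used at the indices 1, 2, \dots
  The adjacency lists may list the neighbours in any order. The entry of the edge array at
  index \<open>m + 1\<close> is the empty element; it is left unconstrained.
\<close>

definition edgelist_rep ::
    "nat pair_pre_digraph \<Rightarrow> nat \<Rightarrow> nat \<Rightarrow> (nat \<Rightarrow> nat) \<Rightarrow> (nat \<Rightarrow> nat) \<Rightarrow> bool" where
  "edgelist_rep G n m es idx \<longleftrightarrow>
     (\<exists>adj :: nat \<Rightarrow> nat list.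
        (\<forall>u\<in>{1..n}. distinct (adj u) \<and> set (adj u) = {w. (u, w) \<in> parcs G}) \<and>
        (\<forall>k<m. es (k + 1) = concat (map adj [1..<n + 1]) ! k) \<and>
        (\<forall>u\<in>{1..n}.
           idx u = (if adj u \<noteq> [] then length (concat (map adj [1..<u])) + 1
                    else if u \<noteq> n then idx (u + 1)
                    else m + 1))) \<and>
     idx (n + 1) = m + 1"

definition sorting_primitive :: "((nat \<Rightarrow> nat) \<Rightarrow> nat list \<Rightarrow> nat list) \<Rightarrow> bool" where
  "sorting_primitive srt \<longleftrightarrow>
     (\<forall>key xs. mset (srt key xs) = mset xs \<and> sorted (map key (srt key xs)))"

record kshell_state =
  deg :: "nat \<Rightarrow> nat"
  vert :: "nat \<Rightarrow> nat"
  pos :: "nat \<Rightarrow> nat"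
  bin :: "nat \<Rightarrow> nat"
  cur_i :: nat
  cur_v :: nat
  cur_j :: nat

text \<open>
  The parameter \<open>lo\<close> is the first index of the array \<open>bin\<close>. The protocol uses \<open>lo = 1\<close>, so that
  \<open>bin\<close> has no cell for vertices of degree 0. With \<open>lo = 0\<close> those vertices are counted
  as well, and the entries of \<open>bin\<close> are the first positions of the degree classes also
  when the graph has isolated vertices.
  Cells that are not initialised (such as \<open>bin n\<close>, which the prefix sums
  nevertheless read) hold the value \<^const>\<open>undefined\<close>.
\<close>

definition init_deg_bin ::
    "nat \<Rightarrow> nat \<Rightarrow> (nat \<Rightarrow> nat) \<Rightarrow> (nat \<Rightarrow> nat) \<times> (nat \<Rightarrow> nat)" where
  "init_deg_bin lo n idx =
     fold (\<lambda>i (dg, bn).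
             let dg' = dg(i := idx (i + 1) - idx i)
             in (dg', bn(dg' i := bn (dg' i) + 1)))
       [1..<n + 1]
       (fold (\<lambda>i dg. dg(i := 0)) [1..<n + 1] undefined,
        fold (\<lambda>i bn. bn(i := 0)) [lo..<n] undefined)"

definition prefix_bin :: "nat \<Rightarrow> nat \<Rightarrow> (nat \<Rightarrow> nat) \<Rightarrow> (nat \<Rightarrow> nat)" where
  "prefix_bin lo n bn0 =
     fst (fold (\<lambda>i (bn, start). (bn(i := start), start + bn i)) [lo..<n + 1] (bn0, 1))"

definition kshell_init ::
    "nat \<Rightarrow> ((nat \<Rightarrow> nat) \<Rightarrow> nat list \<Rightarrow> nat list) \<Rightarrow> nat \<Rightarrow> (nat \<Rightarrow> nat) \<Rightarrow> kshell_state" where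
  "kshell_init lo srt n idx =
     (let (dg, bn) = init_deg_bin lo n idx;
          vs = srt dg [1..<n + 1];
          vt = (\<lambda>i. vs ! (i - 1));
          ps = fold (\<lambda>i ps. ps(vt i := i)) [1..<n + 1] undefined
      in \<lparr>deg = dg, vert = vt, pos = ps, bin = prefix_bin lo n bn,
          cur_i = 1, cur_v = vt 1, cur_j = idx (vt 1)\<rparr>)"

definition relax :: "nat \<Rightarrow> kshell_state \<Rightarrow> kshell_state" where
  "relax u s =
     (if deg s u > deg s (cur_v s) then
        let du = deg s u;
            pu = pos s u;
            pw = bin s du;
            w = vert s pw;
            s' = (if u \<noteq> w
                  then s\<lparr>pos := (pos s)(u := pw, w := pu), vert := (vert s)(pu := w, pw := u)\<rparr>
                  else s)
        in s'\<lparr>bin := (bin s')(du := bin s' du + 1), deg := (deg s')(u := deg s' u - 1)\<rparr>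
      else s)"

definition kshell_step :: "(nat \<Rightarrow> nat) \<Rightarrow> (nat \<Rightarrow> nat) \<Rightarrow> kshell_state \<Rightarrow> kshell_state" where
  "kshell_step es idx s =
     (if cur_j s = idx (cur_v s + 1) then
        let i = cur_i s + 1; v = vert s i
        in s\<lparr>cur_i := i, cur_v := v, cur_j := idx v\<rparr>
      else
        let s' = relax (es (cur_j s)) s
        in s'\<lparr>cur_j := cur_j s' + 1\<rparr>)"

definition kshell_protocol ::
    "nat \<Rightarrow> ((nat \<Rightarrow> nat) \<Rightarrow> nat list \<Rightarrow> nat list) \<Rightarrow> nat \<Rightarrow> nat \<Rightarrow>
     (nat \<Rightarrow> nat) \<Rightarrow> (nat \<Rightarrow> nat) \<Rightarrow> nat \<Rightarrow> nat" where
  "kshell_protocol lo srt n m es idx =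
     deg ((kshell_step es idx ^^ (n + m - 1)) (kshell_init lo srt n idx))"

end

theory Submission
  imports Defs
begin

text \<open>
  The loop keeps the vertices sorted by current degree, with \<open>bin d\<close> the first position of
  degree at least \<open>d\<close>. The degree of a vertex behind the cursor position \<open>i\<close> is the maximum of
  the current level (the degree of the cursor vertex) and the number of its edges that have not
  been traversed. Call a vertex set \<open>k\<close>-dense if each of its vertices has at least \<open>k\<close> neighbours
  in it. Two facts are invariant: members of a \<open>k\<close>-dense set keep degree at least \<open>k\<close>, since a
  vertex that loses degree is adjacent to the cursor vertex, which lies outside the set if its
  level is below \<open>k\<close>; and the vertices of degree at least \<open>k\<close> form a \<open>k\<close>-dense set for every \<open>k\<close> up
  to the current level, since when the level passes \<open>k\<close> these are exactly the vertices not yet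
  processed, whose degrees count their neighbours among themselves. At the end the level is the
  maximal degree, so the degree of \<open>v\<close> is the largest \<open>k\<close> whose \<open>k\<close>-core contains \<open>v\<close>. Each
  iteration either advances the cursor or traverses an edge, hence \<open>n + m - 1\<close> of them suffice.
\<close>

section \<open>Dense sets, cores and shell numbers\<close>

definition dense :: "('a \<times> 'a) set \<Rightarrow> nat \<Rightarrow> 'a set \<Rightarrow> bool" where
  "dense E k W \<longleftrightarrow> (\<forall>u\<in>W. k \<le> card {w\<in>W. (u, w) \<in> E})"

text \<open>Enlarging a set never removes neighbours. This closure under unions is why a largest
  dense set exists.\<close>

lemma dense_Union:
  assumes "finite E" and "\<And>W. W \<in> \<W> \<Longrightarrow> dense E k W"
  shows "dense E k (\<Union>\<W>)"
  unfolding dense_def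
proof
  fix u assume "u \<in> \<Union>\<W>"
  then obtain W where W: "W \<in> \<W>" "u \<in> W" by blast
  have "finite {w \<in> \<Union>\<W>. (u, w) \<in> E}"
    by (rule finite_subset[of _ "snd ` E"]) (use assms(1) in force)+
  then have "card {w\<in>W. (u, w) \<in> E} \<le> card {w \<in> \<Union>\<W>. (u, w) \<in> E}"
    by (rule card_mono) (use W in auto)
  then show "k \<le> card {w \<in> \<Union>\<W>. (u, w) \<in> E}"
    using assms(2)[OF W(1)] W(2) unfolding dense_def by force
qed

lemma out_degree_with_proj:
  "out_degree (with_proj G) u = card {w. (u, w) \<in> parcs G}"
proof -
  have "out_arcs (with_proj G) u = Pair u ` {w. (u, w) \<in> parcs G}"
    by (auto simp: out_arcs_def)
  then show ?thesis
    by (simp add: out_degree_def card_image inj_on_def)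
qed

lemma out_degree_induce_with_proj:
  assumes "u \<in> W"
  shows "out_degree (with_proj G \<restriction> W) u = card {w\<in>W. (u, w) \<in> parcs G}"
proof -
  have "out_arcs (with_proj G \<restriction> W) u = Pair u ` {w\<in>W. (u, w) \<in> parcs G}"
    using assms by (auto simp: out_arcs_def induce_subgraph_def)
  then show ?thesis
    by (simp add: out_degree_def card_image inj_on_def)
qed

text \<open>\<open>GREATEST\<close> needs an attained maximum: the union of all admissible sets is
  itself admissible by \<open>dense_Union\<close>.\<close>

lemma core_verts_eq:
  assumes "finite (parcs G)"
  shows "core_verts (with_proj G) k = \<Union>{W. W \<subseteq> pverts G \<and> dense (parcs G) k W}"
proof -
  have *: "(\<forall>v\<in>W. k \<le> out_degree (with_proj G \<restriction> W) v) \<longleftrightarrow> dense (parcs G) k W" for W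
    by (simp add: dense_def out_degree_induce_with_proj)
  have "dense (parcs G) k (\<Union>{W. W \<subseteq> pverts G \<and> dense (parcs G) k W})"
    by (rule dense_Union[OF assms]) simp
  then show ?thesis
    unfolding core_verts_def * with_proj_simps by (intro Greatest_equality) auto
qed

text \<open>The two bounds place \<open>v\<close> in the \<open>k\<close>-core exactly for
  \<open>k \<le> d\<close>, so \<open>d\<close> is the only shell index of \<open>v\<close> and
  \<open>THE\<close> is well defined.\<close>

lemma shell_eqI:
  assumes "finite (parcs G)"
    and lower: "\<And>k. k \<le> d \<Longrightarrow> \<exists>W\<subseteq>pverts G. v \<in> W \<and> dense (parcs G) k W"
    and upper: "\<And>k W. \<lbrakk>W \<subseteq> pverts G; v \<in> W; dense (parcs G) k W\<rbrakk> \<Longrightarrow> k \<le> d"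
  shows "shell (with_proj G) v = d"
proof -
  have "v \<in> core_verts (with_proj G) k \<longleftrightarrow> k \<le> d" for k
    unfolding core_verts_eq[OF assms(1)] using lower upper by blast
  then have "v \<in> shell_set (with_proj G) i \<longleftrightarrow> i = d" for i
    by (auto simp: shell_set_def core_def)
  then show ?thesis by (simp add: shell_def)
qed

section \<open>Arrays computed by the initialisation loops\<close>

lemma fold_upd_const: "fold (\<lambda>i f. f(i := c)) xs f = (\<lambda>x. if x \<in> set xs then c else f x)"
  by (induction xs arbitrary: f) auto

lemma fold_upd_inverse:
  assumes "inj_on g (set xs)" "p \<in> set xs"
  shows "fold (\<lambda>i f. f(g i := i)) xs f (g p) = p"
  using assms by (induction xs rule: rev_induct) (auto simp: inj_on_def)

lemma fold_deg_bin:
  "fold (\<lambda>i (dg, bn). let dg' = dg(i := D i) in (dg', bn(dg' i := bn (dg' i) + 1)))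
     [1..<k + 1] (dg, bn) =
   (\<lambda>u. if u \<in> {1..k} then D u else dg u, \<lambda>d. bn d + card {u\<in>{1..k}. D u = d})"
proof (induction k)
  case 0
  then show ?case by simp
next
  case (Suc k)
  have "{u\<in>{1..Suc k}. D u = d} =
    (if D (Suc k) = d then insert (Suc k) {u\<in>{1..k}. D u = d} else {u\<in>{1..k}. D u = d})" for d
    by (auto simp: le_Suc_eq)
  then have "card {u\<in>{1..Suc k}. D u = d} =
    card {u\<in>{1..k}. D u = d} + (if D (Suc k) = d then 1 else 0)" for d
    by simp
  then show ?case using Suc by (auto simp: fun_eq_iff Let_def le_Suc_eq)
qed

lemma fst_init_deg_bin:
  "u \<in> {1..n} \<Longrightarrow> fst (init_deg_bin lo n idx) u = idx (u + 1) - idx u"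
  unfolding init_deg_bin_def fold_deg_bin by simp

lemma snd_init_deg_bin:
  "d \<in> {lo..<n} \<Longrightarrow> snd (init_deg_bin lo n idx) d = card {u\<in>{1..n}. idx (u + 1) - idx u = d}"
  unfolding init_deg_bin_def fold_deg_bin by (simp add: fold_upd_const)

lemma fold_prefix_bin:
  fixes bn :: "nat \<Rightarrow> nat"
  assumes "lo \<le> k"
  shows "fold (\<lambda>i (bn, start). (bn(i := start), start + bn i)) [lo..<k] (bn, a) =
    (\<lambda>d. if d \<in> {lo..<k} then a + sum bn {lo..<d} else bn d, a + sum bn {lo..<k})"
  using assms
proof (induction rule: dec_induct)
  case base
  then show ?case by simp
next
  case (step k)
  then show ?case by (auto simp: fun_eq_iff)
qed

text \<open>Cell \<open>d\<close> receives a sum over smaller cells only, all of them initialised.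
  The uninitialised content of cell \<open>n\<close> reaches only the final \<open>start\<close>,
  which is discarded.\<close>

lemma prefix_bin_init:
  assumes "lo \<le> d" "d \<le> n"
  shows "prefix_bin lo n (snd (init_deg_bin lo n idx)) d =
    1 + card {u\<in>{1..n}. lo \<le> idx (u + 1) - idx u \<and> idx (u + 1) - idx u < d}"
proof -
  let ?D = "\<lambda>u. idx (u + 1) - idx u" and ?b = "snd (init_deg_bin lo n idx)"
  have "prefix_bin lo n ?b d = 1 + sum ?b {lo..<d}"
    using assms by (simp add: prefix_bin_def fold_prefix_bin del: upt_Suc)
  also have "sum ?b {lo..<d} = (\<Sum>e\<in>{lo..<d}. card {u\<in>{1..n}. ?D u = e})"
    using assms by (intro sum.cong) (simp_all add: snd_init_deg_bin)
  also have "\<dots> = card (\<Union>e\<in>{lo..<d}. {u\<in>{1..n}. ?D u = e})"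
    by (rule card_UN_disjoint[symmetric]) auto
  also have "(\<Union>e\<in>{lo..<d}. {u\<in>{1..n}. ?D u = e}) = {u\<in>{1..n}. lo \<le> ?D u \<and> ?D u < d}"
    by auto
  finally show ?thesis .
qed

text \<open>Entries with key below \<open>d\<close> form an initial segment of a sorted list, so
  their number decides which positions they occupy.\<close>

lemma sorted_map_less_iff:
  fixes f :: "'a \<Rightarrow> 'b::linorder"
  assumes "sorted (map f xs)" "p < length xs"
  shows "f (xs ! p) < d \<longleftrightarrow> p < length (filter (\<lambda>x. f x < d) xs)"
proof -
  let ?S = "{q. q < length xs \<and> f (xs ! q) < d}"
  have mono: "f (xs ! q) \<le> f (xs ! r)" if "q \<le> r" "r < length xs" for q r
    using sorted_nth_mono[OF assms(1), of q r] that by simp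
  have "p < card ?S" if "f (xs ! p) < d"
  proof -
    have "{..p} \<subseteq> ?S" using mono[of _ p] that assms(2) by fastforce
    from card_mono[OF _ this] show ?thesis by simp
  qed
  moreover have "card ?S \<le> p" if "\<not> f (xs ! p) < d"
  proof -
    have "q < p" if "q \<in> ?S" for q
      using mono[of p q] that \<open>\<not> f (xs ! p) < d\<close> by (cases "p \<le> q") auto
    then have "?S \<subseteq> {..<p}" by auto
    from card_mono[OF _ this] show ?thesis by simp
  qed
  ultimately show ?thesis by (cases "f (xs ! p) < d") (auto simp: length_filter_conv_card)
qed

section \<open>Loop invariants and remaining edges\<close>

text \<open>Hides the adjacency lists: edges are bidirectional, and each slice of \<open>es\<close>
  lists the neighbours of one vertex without repetition, in any order.\<close>

locale kshell_graph =
  fixes E :: "(nat \<times> nat) set" and n :: nat and es idx :: "nat \<Rightarrow> nat"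
  assumes E_subset: "E \<subseteq> {1..n} \<times> {1..n}"
    and E_sym: "(u, w) \<in> E \<Longrightarrow> (w, u) \<in> E"
    and idx_mono: "u \<in> {1..n} \<Longrightarrow> idx u \<le> idx (u + 1)"
    and es_bij: "u \<in> {1..n} \<Longrightarrow> bij_betw es {idx u..<idx (u + 1)} {w. (u, w) \<in> E}"
begin

lemma finite_E: "finite E"
  by (rule finite_subset[OF E_subset]) simp

lemma finite_nbrs: "finite {w. (u, w) \<in> E}"
  by (rule finite_subset[of _ "{1..n}"]) (use E_subset in auto)

text \<open>
  The condition on \<open>bin\<close> also expresses that \<open>vert\<close> is sorted by degree. It covers only \<open>d \<ge> 1\<close>,
  because \<open>bin 0\<close> does not exist in the protocol and is never read by \<^const>\<open>relax\<close>.
\<close>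

definition arrays_ok :: "kshell_state \<Rightarrow> bool" where
  "arrays_ok s \<longleftrightarrow>
     (\<forall>u\<in>{1..n}. deg s u \<le> n \<and> pos s u \<in> {1..n} \<and> vert s (pos s u) = u) \<and>
     (\<forall>p\<in>{1..n}. vert s p \<in> {1..n} \<and> pos s (vert s p) = p) \<and>
     (\<forall>d\<in>{1..n}. 1 \<le> bin s d \<and> (\<forall>p\<in>{1..n}. deg s (vert s p) < d \<longleftrightarrow> p < bin s d))"

definition cursor_ok :: "kshell_state \<Rightarrow> bool" where
  "cursor_ok s \<longleftrightarrow> cur_i s \<in> {1..n} \<and> cur_v s = vert s (cur_i s) \<and>
     cur_j s \<in> {idx (cur_v s)..idx (cur_v s + 1)}"

text \<open>The edges not yet traversed; the second alternative is the unread part of the current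
  slice.\<close>

definition remaining :: "kshell_state \<Rightarrow> (nat \<times> nat) set" where
  "remaining s = {(w, x)\<in>E. cur_i s < pos s w \<or>
     w = cur_v s \<and> x \<in> es ` {cur_j s..<idx (cur_v s + 1)}}"

text \<open>Incoming edges are counted because \<open>u\<close> is relaxed when an edge into it is
  traversed.\<close>

definition pending :: "kshell_state \<Rightarrow> nat \<Rightarrow> nat" where
  "pending s u = card {w. (w, u) \<in> remaining s}"

text \<open>The first clause keeps the other two inductive. At the end the second yields the lower
  bound on the shell number and the third the upper bound.\<close>

definition deg_ok :: "kshell_state \<Rightarrow> bool" where
  "deg_ok s \<longleftrightarrow>
     (\<forall>u\<in>{1..n}. cur_i s < pos s u \<longrightarrow> deg s u = max (deg s (cur_v s)) (pending s u)) \<and>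
     (\<forall>k\<le>deg s (cur_v s). dense E k {u\<in>{1..n}. k \<le> deg s u}) \<and>
     (\<forall>k W. W \<subseteq> {1..n} \<longrightarrow> dense E k W \<longrightarrow> (\<forall>u\<in>W. k \<le> deg s u))"

definition steps_left :: "kshell_state \<Rightarrow> nat" where
  "steps_left s = n - cur_i s + card (remaining s)"

text \<open>Otherwise the boundary \<open>bin s (deg s u)\<close> would separate the two:
  \<open>w\<close> lies before it and \<open>u\<close> does not.\<close>

lemma deg_mono_pos:
  assumes "arrays_ok s" "u \<in> {1..n}" "w \<in> {1..n}" "pos s u \<le> pos s w"
  shows "deg s u \<le> deg s w"
proof (rule ccontr)
  assume "\<not> deg s u \<le> deg s w"
  then have less: "deg s w < deg s u" and d: "deg s u \<in> {1..n}"
    using assms(1,2) by (auto simp: arrays_ok_def)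
  have "deg s (vert s (pos s x)) < deg s u \<longleftrightarrow> pos s x < bin s (deg s u)" if "x \<in> {1..n}" for x
    using assms(1) d that unfolding arrays_ok_def by blast
  from this[OF assms(2)] this[OF assms(3)] show False
    using assms less unfolding arrays_ok_def by auto
qed

lemma cur_v_pos:
  assumes "arrays_ok s" "cursor_ok s"
  shows "cur_v s \<in> {1..n}" "pos s (cur_v s) = cur_i s"
  using assms by (auto simp: arrays_ok_def cursor_ok_def)

lemma finite_remaining: "finite (remaining s)"
  by (rule finite_subset[OF _ finite_E]) (auto simp: remaining_def)

lemma remaining_at_end:
  assumes "cur_j s = idx (cur_v s + 1)"
  shows "remaining s = {(w, x)\<in>E. cur_i s < pos s w}"
  using assms by (auto simp: remaining_def)

text \<open>Together with \<open>remaining_at_end\<close> this shows that moving on from an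
  exhausted list leaves the remaining edges unchanged.\<close>

lemma remaining_at_start:
  assumes "arrays_ok s" "cursor_ok s" "cur_j s = idx (cur_v s)"
  shows "remaining s = {(w, x)\<in>E. cur_i s \<le> pos s w}"
proof -
  have v: "cur_v s \<in> {1..n}" "pos s (cur_v s) = cur_i s"
    using cur_v_pos[OF assms(1,2)] by auto
  have "es ` {cur_j s..<idx (cur_v s + 1)} = {w. (cur_v s, w) \<in> E}"
    using es_bij[OF v(1)] assms(3) by (simp add: bij_betw_def)
  moreover have "w = cur_v s" if "(w, x) \<in> E" "cur_i s = pos s w" for w x
  proof -
    have "w \<in> {1..n}" using that E_subset by auto
    then have "vert s (pos s w) = w" using assms(1) unfolding arrays_ok_def by blast
    then show ?thesis using that(2) assms(2) unfolding cursor_ok_def by simp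
  qed
  ultimately have "(w, x) \<in> remaining s \<longleftrightarrow> (w, x) \<in> E \<and> cur_i s \<le> pos s w" for w x
    using v by (cases "w = cur_v s") (auto simp: remaining_def le_less)
  then show ?thesis by auto
qed

section \<open>Advancing the cursor\<close>

text \<open>With the list at the last position exhausted no edge remains, so the cursor never moves
  past \<open>n\<close> while steps are left.\<close>

lemma steps_left_advance:
  assumes "arrays_ok s" "cursor_ok s" "cur_j s = idx (cur_v s + 1)" "steps_left s \<noteq> 0"
  shows "cur_i s < n"
proof (rule ccontr)
  assume "\<not> cur_i s < n"
  then have "\<not> cur_i s < pos s w" if "(w, x) \<in> E" for w x
    using that E_subset assms(1) unfolding arrays_ok_def by fastforce
  then have "remaining s = {}" unfolding remaining_at_end[OF assms(3)] by auto
  then show False using \<open>\<not> cur_i s < n\<close> assms(4) by (simp add: steps_left_def)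
qed

lemma kshell_step_advance:
  assumes A: "arrays_ok s" and C: "cursor_ok s" and D: "deg_ok s"
    and j: "cur_j s = idx (cur_v s + 1)" and i: "cur_i s < n"
  defines "t \<equiv> kshell_step es idx s"
  shows "arrays_ok t" "cursor_ok t" "deg_ok t" "steps_left s = Suc (steps_left t)"
proof -
  let ?v = "cur_v s" and ?v' = "vert s (cur_i s + 1)"
  have [simp]: "deg t = deg s" "vert t = vert s" "pos t = pos s" "bin t = bin s"
    "cur_i t = cur_i s + 1" "cur_v t = ?v'" "cur_j t = idx ?v'"
    using j by (simp_all add: t_def kshell_step_def Let_def)
  show At: "arrays_ok t" using A by (simp add: arrays_ok_def)
  have v': "?v' \<in> {1..n}" "pos s ?v' = cur_i s + 1"
    using A i unfolding arrays_ok_def by auto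
  show Ct: "cursor_ok t"
    using i idx_mono[OF v'(1)] by (auto simp: cursor_ok_def)
  have v: "?v \<in> {1..n}" "pos s ?v = cur_i s" using cur_v_pos[OF A C] by auto
  have rem: "remaining t = remaining s"
    using remaining_at_start[OF At Ct] remaining_at_end[OF j] by (simp add: Suc_le_eq)
  then show "steps_left s = Suc (steps_left t)" using i by (simp add: steps_left_def)
  have later: "deg s u = max (deg s ?v) (pending s u)" if "u \<in> {1..n}" "cur_i s < pos s u" for u
    using D that unfolding deg_ok_def by blast
  have vv': "deg s ?v \<le> deg s ?v'"
    using deg_mono_pos[OF A v(1) v'(1)] v v' by simp
  show "deg_ok t"
    unfolding deg_ok_def
  proof (intro conjI ballI allI impI)
    fix u assume u: "u \<in> {1..n}" "cur_i t < pos t u"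
    \<comment> \<open>\<open>deg s u\<close> is at least the new level, so replacing the old level
      by the new one does not change the maximum.\<close>
    have "deg s ?v' \<le> deg s u" using deg_mono_pos[OF A v'(1) u(1)] v' u by simp
    then show "deg t u = max (deg t (cur_v t)) (pending t u)"
      using later[of u] u vv' rem by (auto simp: pending_def max_def split: if_splits)
  next
    fix k assume k: "k \<le> deg t (cur_v t)"
    show "dense E k {u\<in>{1..n}. k \<le> deg t u}"
    proof (cases "k \<le> deg s ?v")
      case True
      then show ?thesis using D by (simp add: deg_ok_def)
    next
      case False
      \<comment> \<open>Here \<open>k\<close> is above the old level and at most the new one, so
        sortedness turns the degree bound into a position bound.\<close>
      have iff: "k \<le> deg s u \<longleftrightarrow> cur_i s < pos s u" if "u \<in> {1..n}" for u
        using deg_mono_pos[OF A that v(1)] deg_mono_pos[OF A v'(1) that] v v' False k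
        by force
      show ?thesis
        unfolding dense_def
      proof
        fix u assume "u \<in> {u\<in>{1..n}. k \<le> deg t u}"
        then have u: "u \<in> {1..n}" "cur_i s < pos s u" and ku: "k \<le> deg s u" using iff by auto
        \<comment> \<open>Symmetry turns the remaining edges into \<open>u\<close> into neighbours
          of degree at least \<open>k\<close>. As \<open>deg s u\<close> exceeds the old level,
          \<open>later\<close> makes it equal to their number.\<close>
        have "{w. (w, u) \<in> remaining s} = {w\<in>{u\<in>{1..n}. k \<le> deg t u}. (u, w) \<in> E}"
          unfolding remaining_at_end[OF j] using iff E_sym E_subset by auto
        then show "k \<le> card {w\<in>{u\<in>{1..n}. k \<le> deg t u}. (u, w) \<in> E}"
          using later[OF u] ku False by (simp add: pending_def max_def split: if_splits)
      qed
    qed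
  next
    fix k W u assume "W \<subseteq> {1..n}" "dense E k W" "u \<in> W"
    then show "k \<le> deg t u" using D unfolding deg_ok_def by auto
  qed
qed

section \<open>Traversing an edge\<close>

lemma relax_frame [simp]:
  "cur_i (relax u s) = cur_i s" "cur_v (relax u s) = cur_v s" "cur_j (relax u s) = cur_j s"
  by (simp_all add: relax_def Let_def)

lemma deg_relax:
  "deg (relax u s) = (if deg s (cur_v s) < deg s u then (deg s)(u := deg s u - 1) else deg s)"
  by (simp add: relax_def Let_def)

text \<open>Covers \<open>u = w\<close> as well: the swap is then the identity, so one formula
  serves both branches of \<open>relax\<close>.\<close>

lemma relax_decrease:
  assumes "deg s (cur_v s) < d" "deg s u = d" "bin s d = b" "vert s b = w"
    "vert s p = u" "pos s u = p" "pos s w = b"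
  shows "relax u s = s\<lparr>pos := (pos s)(u := b, w := p), vert := (vert s)(p := w, b := u),
    bin := (bin s)(d := b + 1), deg := (deg s)(u := d - 1)\<rparr>"
proof (cases "u = w")
  case True
  then have "p = b" using assms by simp
  have "(pos s)(u := b, w := p) = pos s" "(vert s)(p := w, b := u) = vert s"
    using True \<open>p = b\<close> assms by (auto simp: fun_eq_iff)
  moreover have "s\<lparr>pos := pos s, vert := vert s\<rparr> = s" by simp
  moreover have "relax u s = s\<lparr>bin := (bin s)(d := b + 1), deg := (deg s)(u := d - 1)\<rparr>"
    unfolding relax_def Let_def assms(2-4) using True[symmetric] assms(1-3) by simp
  ultimately show ?thesis by (simp only:)
next
  case False
  then show ?thesis
    unfolding relax_def Let_def assms(2-4,6) using assms(1-3) by simp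
qed

text \<open>\<open>u\<close> is swapped with the first vertex of its degree class and the class
  boundary moves past it, which makes \<open>u\<close> the last vertex of the class below.\<close>

lemma relax_arrays:
  assumes A: "arrays_ok s" and C: "cursor_ok s" and u: "u \<in> {1..n}"
  shows "arrays_ok (relax u s)"
    and "\<And>p. p \<le> cur_i s \<Longrightarrow> vert (relax u s) p = vert s p"
    and "\<And>x. x \<in> {1..n} \<Longrightarrow> cur_i s < pos (relax u s) x \<longleftrightarrow> cur_i s < pos s x"
proof -
  let ?t = "relax u s" and ?v = "cur_v s"
  define d where "d = deg s u"
  define b where "b = bin s d"
  define w where "w = vert s b"
  have v: "?v \<in> {1..n}" "pos s ?v = cur_i s" using cur_v_pos[OF A C] by auto
  have "arrays_ok ?t \<and> (\<forall>p\<le>cur_i s. vert ?t p = vert s p) \<and>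
    (\<forall>x\<in>{1..n}. cur_i s < pos ?t x \<longleftrightarrow> cur_i s < pos s x)"
  proof (cases "deg s ?v < d")
    case False
    then have "?t = s" by (simp add: relax_def d_def)
    then show ?thesis using A by simp
  next
    case True
    have posn: "pos s x \<in> {1..n}" "vert s (pos s x) = x" "deg s x \<le> n" if "x \<in> {1..n}" for x
      using A that unfolding arrays_ok_def by blast+
    have vertn: "vert s p \<in> {1..n}" "pos s (vert s p) = p" if "p \<in> {1..n}" for p
      using A that unfolding arrays_ok_def by blast+
    have binn: "1 \<le> bin s e" "\<And>p. p \<in> {1..n} \<Longrightarrow> deg s (vert s p) < e \<longleftrightarrow> p < bin s e"
      if "e \<in> {1..n}" for e
      using A that unfolding arrays_ok_def by blast+
    have d: "d \<in> {1..n}" using True posn(3)[OF u] by (auto simp: d_def)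
    have bd: "bin s d = b" and du: "deg s u = d" by (simp_all add: b_def d_def)
    have b_le: "b \<le> pos s u"
      using binn(2)[OF d posn(1)[OF u]] posn(2)[OF u] by (simp add: b_def d_def)
    have b: "b \<in> {1..n}" using b_le binn(1)[OF d] posn(1)[OF u] by (auto simp: b_def)
    have w: "w \<in> {1..n}" "pos s w = b" using vertn[OF b] by (auto simp: w_def)
    \<comment> \<open>The degree is not below \<open>d\<close> because \<open>b\<close> is the
      boundary, and not above because \<open>b\<close> is at most the position of
      \<open>u\<close>.\<close>
    have dw: "deg s w = d"
      using binn(2)[OF d b] deg_mono_pos[OF A w(1) u] w(2) b_le by (auto simp: w_def b_def d_def)
    \<comment> \<open>A vertex of degree above the level cannot stand at or before the cursor, so
      both swapped positions come after it.\<close>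
    have ib: "cur_i s < b"
      using deg_mono_pos[OF A w(1) v(1)] dw True v w by force
    have t: "vert ?t = (vert s)(pos s u := w, b := u)" "pos ?t = (pos s)(u := b, w := pos s u)"
      "bin ?t = (bin s)(d := b + 1)" "deg ?t = (deg s)(u := d - 1)"
      using relax_decrease[OF _ du bd w_def[symmetric] posn(2)[OF u] refl w(2)] True by simp_all
    have order: "deg ?t (vert ?t p) < e \<longleftrightarrow> p < bin ?t e" if e: "e \<in> {1..n}" and p: "p \<in> {1..n}" for e p
    proof -
      have pu: "deg s (vert s (pos s u)) = d" "pos s u \<in> {1..n}"
        using posn[OF u] by (auto simp: d_def)
      have wb: "deg s (vert s b) = d" using dw by (simp add: w_def)
      consider "p = b" | "p = pos s u" "p \<noteq> b" | "p \<noteq> b" "p \<noteq> pos s u" by blast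
      then show ?thesis
      proof cases
        case 1
        then have "deg ?t (vert ?t p) = d - 1" by (simp add: t)
        \<comment> \<open>Only the comparison with \<open>e = d\<close> changes, and that is the
          boundary moved from \<open>b\<close> to \<open>b + 1\<close>.\<close>
        moreover have "d - 1 < e \<longleftrightarrow> d < e \<or> e = d" using d by auto
        ultimately show ?thesis using binn(2)[OF e b] wb 1 by (auto simp: t)
      next
        case 2
        then have "w \<noteq> u" using w by auto
        then have "deg ?t (vert ?t p) = d" using 2 dw by (simp add: t)
        then show ?thesis using binn(2)[OF e pu(2)] pu(1) 2 b_le by (auto simp: t)
      next
        case 3
        then have "vert ?t p = vert s p" by (simp add: t)
        moreover have "vert s p \<noteq> u" using vertn(2)[OF p] 3 by auto
        ultimately have "deg ?t (vert ?t p) = deg s (vert s p)" by (simp add: t)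
        then show ?thesis using binn(2)[OF e p] 3 bd by (auto simp: t)
      qed
    qed
    have "arrays_ok ?t"
      unfolding arrays_ok_def
    proof (intro conjI ballI)
      fix x assume x: "x \<in> {1..n}"
      show "deg ?t x \<le> n" using posn[OF x] d by (auto simp: t)
      show "pos ?t x \<in> {1..n}" using posn[OF x] posn[OF u] b by (auto simp: t)
      have inj: "pos s x \<noteq> pos s y" if "y \<in> {1..n}" "x \<noteq> y" for y
        using posn(2)[OF x] posn(2)[OF that(1)] that(2) by metis
      consider "x = w" | "x = u" "x \<noteq> w" | "x \<noteq> u" "x \<noteq> w" by blast
      then show "vert ?t (pos ?t x) = x"
      proof cases
        case 1
        have "u = w" if "pos s u = b"
          using that w(2) posn(2)[OF u] posn(2)[OF w(1)] by metis
        then show ?thesis using 1 by (simp add: t)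
      next
        case 2
        then show ?thesis by (simp add: t)
      next
        case 3
        then show ?thesis using inj[OF u] inj[OF w(1)] w(2) posn(2)[OF x] by (simp add: t)
      qed
    next
      fix p assume p: "p \<in> {1..n}"
      show "vert ?t p \<in> {1..n}" using vertn[OF p] u w by (auto simp: t)
      show "pos ?t (vert ?t p) = p" using vertn[OF p] w by (auto simp: t)
    next
      fix e assume e: "e \<in> {1..n}"
      show "1 \<le> bin ?t e" using binn(1)[OF e] by (simp add: t)
      fix p assume "p \<in> {1..n}"
      then show "deg ?t (vert ?t p) < e \<longleftrightarrow> p < bin ?t e" using order[OF e] by blast
    qed
    then show ?thesis using ib b_le w by (auto simp: t)
  qed
  then show "arrays_ok ?t" "\<And>p. p \<le> cur_i s \<Longrightarrow> vert ?t p = vert s p"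
    "\<And>x. x \<in> {1..n} \<Longrightarrow> cur_i s < pos ?t x \<longleftrightarrow> cur_i s < pos s x" by auto
qed

lemma kshell_step_edge:
  assumes A: "arrays_ok s" and C: "cursor_ok s" and D: "deg_ok s"
    and j: "cur_j s \<noteq> idx (cur_v s + 1)"
  defines "t \<equiv> kshell_step es idx s"
  shows "arrays_ok t" "cursor_ok t" "deg_ok t" "steps_left s = Suc (steps_left t)"
proof -
  let ?v = "cur_v s"
  define u where "u = es (cur_j s)"
  have v: "?v \<in> {1..n}" "pos s ?v = cur_i s" using cur_v_pos[OF A C] by auto
  have j': "cur_j s \<in> {idx ?v..<idx (?v + 1)}" using C j by (auto simp: cursor_ok_def)
  then have vu: "(?v, u) \<in> E"
    using es_bij[OF v(1)] by (auto simp: bij_betw_def u_def)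
  then have u: "u \<in> {1..n}" using E_subset by auto
  note relax = relax_arrays[OF A C u]
  have t: "t = (relax u s)\<lparr>cur_j := cur_j s + 1\<rparr>"
    using j by (simp add: t_def kshell_step_def u_def Let_def)
  have [simp]: "cur_i t = cur_i s" "cur_v t = ?v" "cur_j t = cur_j s + 1"
    by (simp_all add: t)
  have deg_t: "deg t = (if deg s ?v < deg s u then (deg s)(u := deg s u - 1) else deg s)"
    by (simp add: t deg_relax)
  have pos_t: "cur_i s < pos t x \<longleftrightarrow> cur_i s < pos s x" if "x \<in> {1..n}" for x
    using relax(3)[OF that] by (simp add: t)
  show At: "arrays_ok t" using relax(1) by (simp add: t arrays_ok_def)
  show Ct: "cursor_ok t" using C j' relax(2)[of "cur_i s"] by (auto simp: t cursor_ok_def)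
  have "{cur_j s..<idx (?v + 1)} = insert (cur_j s) {cur_j s + 1..<idx (?v + 1)}"
    using j' by auto
  \<comment> \<open>No neighbour is listed twice, so reading this entry removes exactly the edge
    from the cursor vertex to \<open>u\<close>.\<close>
  moreover have "u \<notin> es ` {cur_j s + 1..<idx (?v + 1)}"
  proof
    assume "u \<in> es ` {cur_j s + 1..<idx (?v + 1)}"
    then obtain k where k: "k \<in> {cur_j s + 1..<idx (?v + 1)}" "es k = es (cur_j s)"
      by (auto simp: u_def)
    have "inj_on es {idx ?v..<idx (?v + 1)}" using es_bij[OF v(1)] by (simp add: bij_betw_def)
    from inj_onD[OF this k(2)] show False using k j' by auto
  qed
  ultimately have rem: "remaining s = insert (?v, u) (remaining t)" "(?v, u) \<notin> remaining t"
    using vu v pos_t E_subset by (auto simp: remaining_def u_def[symmetric])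
  then show "steps_left s = Suc (steps_left t)"
    using finite_remaining[of t] by (simp add: steps_left_def)
  have fin: "finite {w. (w, x) \<in> remaining r}" for x r
    by (rule finite_subset[of _ "fst ` remaining r"]) (use finite_remaining in force)+
  have pending_s: "pending s x = (if x = u then Suc (pending t x) else pending t x)" for x
  proof -
    have "{w. (w, x) \<in> remaining s} =
      (if x = u then insert ?v {w. (w, x) \<in> remaining t} else {w. (w, x) \<in> remaining t})"
      using rem by auto
    then show ?thesis using rem(2) fin[of x t] by (cases "x = u") (simp_all add: pending_def)
  qed
  have later: "deg s x = max (deg s ?v) (pending s x)" if "x \<in> {1..n}" "cur_i s < pos s x" for x
    using D that unfolding deg_ok_def by blast
  have early: "deg s x \<le> deg s ?v" if "x \<in> {1..n}" "\<not> cur_i s < pos s x" for x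
    using deg_mono_pos[OF A that(1) v(1)] that v by simp
  \<comment> \<open>The test in \<open>relax\<close> is strict, so even a loop does not lower the
    level.\<close>
  have deg_v: "deg t ?v = deg s ?v" by (auto simp: deg_t)
  show "deg_ok t"
    unfolding deg_ok_def
  proof (intro conjI ballI allI impI)
    fix x assume x: "x \<in> {1..n}" "cur_i t < pos t x"
    then have "cur_i s < pos s x" using pos_t by auto
    \<comment> \<open>For \<open>x = u\<close> the degree exceeds the level exactly when the pending
      count does, and then both drop by one.\<close>
    from later[OF x(1) this]
    have "deg t x = max (deg s ?v) (pending t x)"
      by (auto simp: deg_t pending_s max_def split: if_splits)
    then show "deg t x = max (deg t (cur_v t)) (pending t x)" using deg_v by simp
  next
    fix k assume "k \<le> deg t (cur_v t)"
    then have k: "k \<le> deg s ?v" using deg_v by simp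
    \<comment> \<open>A degree is lowered only from above the level, so it stays at least
      \<open>k\<close>.\<close>
    then have "k \<le> deg t x \<longleftrightarrow> k \<le> deg s x" for x by (auto simp: deg_t)
    then show "dense E k {x\<in>{1..n}. k \<le> deg t x}" using D k by (simp add: deg_ok_def)
  next
    fix k W x assume W: "W \<subseteq> {1..n}" "dense E k W" and x: "x \<in> W"
    have W_deg: "k \<le> deg s y" if "y \<in> W" for y using D W that unfolding deg_ok_def by blast
    show "k \<le> deg t x"
    proof (rule ccontr)
      assume "\<not> k \<le> deg t x"
      then have *: "x = u" "deg s u = k" "deg s ?v < k"
        using W_deg[OF x] by (auto simp: deg_t split: if_splits)
      \<comment> \<open>Members of \<open>W\<close> have degrees above the level, so all of them
        come after the cursor and their edges are untraversed.\<close>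
      have "cur_i s < pos s y" if "y \<in> W" for y
        using early[of y] W_deg[OF that] W(1) that *(3) by fastforce
      then have "{w\<in>W. (u, w) \<in> E} \<subseteq> {w. (w, u) \<in> remaining s}" and "cur_i s < pos s u"
        using E_sym x * by (auto simp: remaining_def)
      \<comment> \<open>The edge just traversed starts outside \<open>W\<close>, so at least
        \<open>k\<close> edges into \<open>u\<close> are still pending. Before the step there was
        one more, contradicting \<open>deg s u = k\<close>.\<close>
      moreover have "?v \<notin> W" using W_deg[of ?v] * by auto
      ultimately have "{w\<in>W. (u, w) \<in> E} \<subseteq> {w. (w, u) \<in> remaining t}"
        using rem by auto
      then have "card {w\<in>W. (u, w) \<in> E} \<le> pending t u"
        unfolding pending_def by (rule card_mono[OF fin])
      then have "k \<le> pending t u" using W(2) x * unfolding dense_def by force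
      then show False using later[OF u \<open>cur_i s < pos s u\<close>] * pending_s[of u] by simp
    qed
  qed
qed

section \<open>Running the loop to its end\<close>

lemma kshell_run:
  assumes "arrays_ok s" "cursor_ok s" "deg_ok s"
  defines "t \<equiv> (kshell_step es idx ^^ steps_left s) s"
  shows "arrays_ok t \<and> cursor_ok t \<and> deg_ok t \<and> steps_left t = 0"
proof -
  have "arrays_ok ((kshell_step es idx ^^ k) s) \<and> cursor_ok ((kshell_step es idx ^^ k) s) \<and>
    deg_ok ((kshell_step es idx ^^ k) s) \<and> steps_left ((kshell_step es idx ^^ k) s) = steps_left s - k"
    if "k \<le> steps_left s" for k
    using that
  proof (induction k)
    case 0
    then show ?case using assms by simp
  next
    case (Suc k)
    let ?r = "(kshell_step es idx ^^ k) s"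
    have r: "arrays_ok ?r" "cursor_ok ?r" "deg_ok ?r" "steps_left ?r = steps_left s - k"
      using Suc by auto
    have "cur_j ?r = idx (cur_v ?r + 1) \<Longrightarrow> cur_i ?r < n"
      using steps_left_advance[OF r(1,2)] r(4) Suc.prems by simp
    then show ?case
      using kshell_step_advance[OF r(1-3)] kshell_step_edge[OF r(1-3)] r(4)
      by (cases "cur_j ?r = idx (cur_v ?r + 1)") auto
  qed
  then show ?thesis by (simp add: t_def)
qed

text \<open>In the end the cursor is at position \<open>n\<close>, so the level is the maximal
  degree and the second clause of \<open>deg_ok\<close> reaches every \<open>k\<close> in
  question.\<close>

lemma deg_final_dense:
  assumes "arrays_ok s" "cursor_ok s" "deg_ok s" "steps_left s = 0" "u \<in> {1..n}" "k \<le> deg s u"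
  shows "dense E k {w\<in>{1..n}. k \<le> deg s w}"
proof -
  have "cur_i s = n" using assms(2,4) by (auto simp: cursor_ok_def steps_left_def)
  then have "pos s u \<le> pos s (cur_v s)"
    using cur_v_pos[OF assms(1,2)] assms(1,5) by (auto simp: arrays_ok_def)
  then have "k \<le> deg s (cur_v s)"
    using deg_mono_pos[OF assms(1,5) cur_v_pos(1)[OF assms(1,2)]] assms(6) by simp
  then show ?thesis using assms(3) by (auto simp: deg_ok_def)
qed

section \<open>The initial state and correctness\<close>

text \<open>For \<open>lo = 1\<close> every slice is nonempty, so the missing cell for degree 0
  would count nothing and the prefix sums are still the class boundaries.\<close>

lemma kshell_init_ok:
  assumes srt: "sorting_primitive srt" and n: "1 \<le> n"
    and lo: "lo = 0 \<or> lo = 1 \<and> (\<forall>u\<in>{1..n}. idx u \<noteq> idx (u + 1))"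
  defines "s \<equiv> kshell_init lo srt n idx"
  shows "arrays_ok s" "cursor_ok s" "deg_ok s" "steps_left s = n + card E - 1"
proof -
  define D where "D u = idx (u + 1) - idx u" for u
  define dg where "dg = fst (init_deg_bin lo n idx)"
  define vs where "vs = srt dg [1..<n + 1]"
  have nbrs: "card {w. (u, w) \<in> E} = D u" if "u \<in> {1..n}" for u
    using bij_betw_same_card[OF es_bij[OF that]] by (simp add: D_def)
  have dg: "dg u = D u" if "u \<in> {1..n}" for u
    using that by (simp add: dg_def fst_init_deg_bin D_def)
  have D_le: "D u \<le> n" if "u \<in> {1..n}" for u
  proof -
    have "card {w. (u, w) \<in> E} \<le> card {1..n}"
      by (rule card_mono) (use E_subset in auto)
    then show ?thesis using nbrs[OF that] by simp
  qed
  have mset_vs: "mset vs = mset [1..<n + 1]" and sorted_vs: "sorted (map dg vs)"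
    using srt by (simp_all add: sorting_primitive_def vs_def)
  have set_vs: "set vs = {1..n}" and length_vs: "length vs = n"
    using mset_eq_setD[OF mset_vs] mset_eq_length[OF mset_vs] by auto
  have "distinct vs" using mset_eq_imp_distinct_iff[OF mset_vs] by simp
  then have inj: "inj_on (\<lambda>i. vs ! (i - 1)) {1..n}"
    using length_vs by (intro inj_onI) (auto simp: nth_eq_iff_index_eq)
  have s: "deg s = dg" "vert s = (\<lambda>i. vs ! (i - 1))" "cur_i s = 1" "cur_v s = vert s 1"
    "pos s = fold (\<lambda>i ps. ps(vs ! (i - 1) := i)) [1..<n + 1] undefined"
    "bin s = prefix_bin lo n (snd (init_deg_bin lo n idx))" "cur_j s = idx (cur_v s)"
    by (simp_all add: s_def kshell_init_def Let_def split_beta dg_def vs_def)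
  have vert: "vert s p \<in> {1..n}" "pos s (vert s p) = p" if p: "p \<in> {1..n}" for p
  proof -
    have "vs ! (p - 1) \<in> set vs" using p length_vs by (intro nth_mem) auto
    then show "vert s p \<in> {1..n}" using set_vs by (simp add: s)
    show "pos s (vert s p) = p"
      unfolding s by (rule fold_upd_inverse)
        (use inj p in \<open>simp_all add: atLeastLessThanSuc_atLeastAtMost del: upt_Suc\<close>)
  qed
  have pos: "pos s u \<in> {1..n} \<and> vert s (pos s u) = u" if "u \<in> {1..n}" for u
  proof -
    have "u \<in> set vs" using that set_vs by simp
    then obtain q where "q < n" "vs ! q = u" unfolding in_set_conv_nth length_vs by blast
    then have "Suc q \<in> {1..n}" "vert s (Suc q) = u" by (auto simp: s)
    then show ?thesis using vert(2)[of "Suc q"] by simp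
  qed
  have bin: "bin s d = 1 + card {u\<in>{1..n}. D u < d}" if "d \<in> {1..n}" for d
  proof -
    have "D u \<noteq> 0" if "u \<in> {1..n}" "lo = 1" for u
      using lo that idx_mono[OF that(1)] by (force simp: D_def)
    then have "{u\<in>{1..n}. lo \<le> D u \<and> D u < d} = {u\<in>{1..n}. D u < d}"
      using lo by (auto simp: Suc_le_eq)
    then show ?thesis using prefix_bin_init[of lo d n idx] that lo by (auto simp: s D_def)
  qed
  show A: "arrays_ok s"
    unfolding arrays_ok_def
  proof (intro conjI ballI)
    fix d p assume d: "d \<in> {1..n}" and p: "p \<in> {1..n}"
    have "length (filter (\<lambda>u. dg u < d) vs) = size (filter_mset (\<lambda>u. dg u < d) (mset vs))"
      by (metis mset_filter size_mset)
    also have "\<dots> = length (filter (\<lambda>u. dg u < d) [1..<n + 1])"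
      unfolding mset_vs by (metis mset_filter size_mset)
    also have "\<dots> = card {u\<in>{1..n}. D u < d}"
      using dg by (subst distinct_card[symmetric]) (auto intro!: arg_cong[where f = card])
    \<comment> \<open>Position \<open>p\<close> is list index \<open>p - 1\<close>; the leading 1 in
      \<open>bin\<close> compensates for this shift.\<close>
    finally have "p - 1 < length (filter (\<lambda>u. dg u < d) vs) \<longleftrightarrow> p < bin s d"
      using bin[OF d] p by auto
    moreover have "p - 1 < length vs" using p length_vs by auto
    ultimately show "deg s (vert s p) < d \<longleftrightarrow> p < bin s d"
      using sorted_map_less_iff[OF sorted_vs, of "p - 1" d] by (simp add: s(1,2))
  next
    fix u assume "u \<in> {1..n}"
    then show "deg s u \<le> n" using dg D_le by (simp add: s)
  qed (use vert pos bin in auto)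
  show C: "cursor_ok s"
    using vert(1)[of 1] idx_mono[of "cur_v s"] n by (auto simp: cursor_ok_def s)
  have pos1: "1 \<le> pos s u" if "u \<in> {1..n}" for u using pos[OF that] by simp
  have rem: "remaining s = E"
    using remaining_at_start[OF A C s(7)] pos1 E_subset by (auto simp: s)
  then show "steps_left s = n + card E - 1" using n by (simp add: steps_left_def s)
  have v: "cur_v s \<in> {1..n}" "pos s (cur_v s) = 1" using cur_v_pos[OF A C] s by auto
  have deg_v: "deg s (cur_v s) \<le> deg s u" if "u \<in> {1..n}" for u
    using deg_mono_pos[OF A v(1) that] v pos1[OF that] by simp
  have deg_E: "deg s u = card {w. (u, w) \<in> E}" if "u \<in> {1..n}" for u
    using nbrs[OF that] dg[OF that] by (simp add: s)
  show "deg_ok s"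
    unfolding deg_ok_def
  proof (intro conjI ballI allI impI)
    fix u assume u: "u \<in> {1..n}"
    \<comment> \<open>By symmetry all incoming edges together number the degree; it is at least the
      level because the cursor is at a vertex of minimal degree.\<close>
    have "{w. (w, u) \<in> E} = {w. (u, w) \<in> E}" using E_sym by auto
    then show "deg s u = max (deg s (cur_v s)) (pending s u)"
      using deg_E[OF u] deg_v[OF u] by (simp add: pending_def rem)
  next
    fix k assume k: "k \<le> deg s (cur_v s)"
    then have "k \<le> deg s u" if "u \<in> {1..n}" for u using deg_v[OF that] by simp
    moreover have "{w\<in>{1..n}. (u, w) \<in> E} = {w. (u, w) \<in> E}" for u using E_subset by auto
    ultimately have "{u\<in>{1..n}. k \<le> deg s u} = {1..n}" "dense E k {1..n}"
      using deg_E by (auto simp: dense_def)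
    then show "dense E k {u\<in>{1..n}. k \<le> deg s u}" by simp
  next
    fix k W u assume W: "W \<subseteq> {1..n}" "dense E k W" "u \<in> W"
    then have u: "u \<in> {1..n}" by auto
    have "card {w\<in>W. (u, w) \<in> E} \<le> card {w. (u, w) \<in> E}"
      by (rule card_mono) (use finite_nbrs in auto)
    then show "k \<le> deg s u" using W deg_E[OF u] by (force simp: dense_def)
  qed
qed

text \<open>The iteration count is \<open>steps_left\<close> of the initial state, so the loop ends
  with no step left, where \<open>deg_ok\<close> gives both bounds of
  \<open>shell_eqI\<close>.\<close>

theorem kshell_protocol_eq_shell:
  assumes "parcs G = E" "pverts G = {1..n}" "sorting_primitive srt"
    and "lo = 0 \<or> lo = 1 \<and> (\<forall>u\<in>{1..n}. idx u \<noteq> idx (u + 1))"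
    and v: "v \<in> {1..n}"
  shows "kshell_protocol lo srt n (card E) es idx v = shell (with_proj G) v"
proof -
  define s where "s = kshell_init lo srt n idx"
  define t where "t = (kshell_step es idx ^^ steps_left s) s"
  have "1 \<le> n" using v by simp
  note init = kshell_init_ok[OF assms(3) this assms(4), folded s_def]
  have t: "arrays_ok t" "cursor_ok t" "deg_ok t" "steps_left t = 0"
    using kshell_run[OF init(1-3)] by (simp_all add: t_def)
  have "shell (with_proj G) v = deg t v"
  proof (rule shell_eqI)
    fix k assume "k \<le> deg t v"
    then show "\<exists>W\<subseteq>pverts G. v \<in> W \<and> dense (parcs G) k W"
      using deg_final_dense[OF t v] v assms(1,2)
      by (intro exI[of _ "{w\<in>{1..n}. k \<le> deg t w}"]) auto
  next
    fix k W assume "W \<subseteq> pverts G" "v \<in> W" "dense (parcs G) k W"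
    then show "k \<le> deg t v" using t(3) assms(1,2) by (auto simp: deg_ok_def)
  qed (use finite_E assms(1) in simp)
  then show ?thesis
    by (simp add: kshell_protocol_def t_def init(4) flip: s_def)
qed

end

section \<open>From the edge list representation to neighbour slices\<close>

text \<open>Each \<open>idx u\<close> is one more than the total length of the lists before
  \<open>u\<close>, so the slice from \<open>idx u\<close> up to \<open>idx (u + 1)\<close> is the
  adjacency list of \<open>u\<close>.\<close>

lemma kshell_graph_edgelist_rep:
  assumes G: "pair_pseudo_graph G" "pverts G = {1..n}" and m: "card (parcs G) = m"
    and rep: "edgelist_rep G n m es idx"
  shows "kshell_graph (parcs G) n es idx"
proof -
  interpret pair_pseudo_graph G by fact
  have sub: "parcs G \<subseteq> {1..n} \<times> {1..n}" using in_arcsD1 in_arcsD2 G(2) by auto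
  obtain adj where adj: "\<And>u. u \<in> {1..n} \<Longrightarrow> distinct (adj u)"
      "\<And>u. u \<in> {1..n} \<Longrightarrow> set (adj u) = {w. (u, w) \<in> parcs G}"
    and es: "\<And>k. k < m \<Longrightarrow> es (k + 1) = concat (map adj [1..<n + 1]) ! k"
    and idx: "\<And>u. u \<in> {1..n} \<Longrightarrow> idx u = (if adj u \<noteq> [] then length (concat (map adj [1..<u])) + 1
      else if u \<noteq> n then idx (u + 1) else m + 1)"
    and idx_end: "idx (n + 1) = m + 1"
    using rep unfolding edgelist_rep_def by blast
  define L where "L u = length (concat (map adj [1..<u]))" for u
  have L_Suc: "L (Suc u) = L u + length (adj u)" if "1 \<le> u" for u
    using that by (simp add: L_def)
  have L_end: "L (n + 1) = m"
  proof -
    have "L (n + 1) = (\<Sum>u\<in>{1..n}. length (adj u))"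
      by (simp add: L_def length_concat sum_set_upt_conv_sum_list_nat[symmetric] o_def
          atLeastLessThanSuc_atLeastAtMost del: upt_Suc)
    also have "\<dots> = (\<Sum>u\<in>{1..n}. card {w. (u, w) \<in> parcs G})"
      using adj by (intro sum.cong refl) (simp add: distinct_card flip: adj(2))
    also have "\<dots> = card (SIGMA u:{1..n}. {w. (u, w) \<in> parcs G})"
      by (rule card_SigmaI[symmetric]) (use finite_subset[of "{w. (u, w) \<in> parcs G}" "{1..n}" for u] sub in auto)
    also have "(SIGMA u:{1..n}. {w. (u, w) \<in> parcs G}) = parcs G" using sub by auto
    finally show ?thesis using m by simp
  qed
  \<comment> \<open>The induction runs downwards from \<open>n + 1\<close>, since \<open>idx\<close>
    at an empty list is given by its successor.\<close>
  have idx_L: "idx u = L u + 1" if "1 \<le> u" "u \<le> n + 1" for u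
    using that(2,1)
  proof (induction rule: inc_induct)
    case base
    then show ?case using idx_end L_end by simp
  next
    case (step u)
    then show ?case using idx[of u] idx_end L_Suc[of u] by (auto simp: L_def)
  qed
  have es_adj: "es (L u + 1 + k) = adj u ! k" if u: "u \<in> {1..n}" and k: "k < length (adj u)" for u k
  proof -
    have "[1..<n + 1] = [1..<u] @ u # [Suc u..<n + 1]"
      using upt_add_eq_append[of 1 u "n + 1 - u"] upt_conv_Cons[of u "n + 1"] u by simp
    then have c: "concat (map adj [1..<n + 1]) =
        concat (map adj [1..<u]) @ adj u @ concat (map adj [Suc u..<n + 1])" by simp
    then have "L u + k < m" using k L_end by (simp add: L_def)
    from es[OF this] show ?thesis
      unfolding c using k by (simp add: nth_append L_def add.commute add.left_commute)
  qed
  show ?thesis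
  proof
    fix u assume u: "u \<in> {1..n}"
    have ends: "idx u = L u + 1" "idx (u + 1) = L u + 1 + length (adj u)"
      using idx_L[of u] idx_L[of "u + 1"] L_Suc[of u] u by auto
    show "idx u \<le> idx (u + 1)" using ends by simp
    have "bij_betw ((!) (adj u)) {..<length (adj u)} {w. (u, w) \<in> parcs G}"
      by (rule bij_betw_nth) (use adj u in auto)
    moreover have "bij_betw (\<lambda>j. j - (L u + 1)) {idx u..<idx (u + 1)} {..<length (adj u)}"
      by (rule bij_betw_byWitness[of _ "\<lambda>k. L u + 1 + k"]) (use ends in auto)
    ultimately have "bij_betw ((!) (adj u) \<circ> (\<lambda>j. j - (L u + 1))) {idx u..<idx (u + 1)}
        {w. (u, w) \<in> parcs G}" by (rule bij_betw_trans[rotated])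
    moreover have "((!) (adj u) \<circ> (\<lambda>j. j - (L u + 1))) j = es j" if "j \<in> {idx u..<idx (u + 1)}" for j
      using es_adj[OF u, of "j - (L u + 1)"] that ends by auto
    ultimately show "bij_betw es {idx u..<idx (u + 1)} {w. (u, w) \<in> parcs G}"
      using bij_betw_cong by blast
  qed (use sub arcs_symmetric in auto)
qed

theorem theorem1:
  fixes G :: "nat pair_pre_digraph"
    and n m :: nat
    and es idx :: "nat \<Rightarrow> nat"
    and srt :: "(nat \<Rightarrow> nat) \<Rightarrow> nat list \<Rightarrow> nat list"
  assumes "pair_pseudo_graph G"
    and "pverts G = {1..n}"
    and "card (parcs G) = m"
    and "edgelist_rep G n m es idx"
    and "sorting_primitive srt"
  shows "((\<forall>v\<in>pverts G. out_degree G v \<noteq> 0) \<longrightarrow>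
            (\<forall>v\<in>pverts G. kshell_protocol 1 srt n m es idx v = shell G v)) \<and>
         (\<forall>v\<in>pverts G. kshell_protocol 0 srt n m es idx v = shell G v)"
proof -
  interpret K: kshell_graph "parcs G" n es idx
    using kshell_graph_edgelist_rep[OF assms(1-4)] .
  have "out_degree G u = idx (u + 1) - idx u" if "u \<in> {1..n}" for u
    using bij_betw_same_card[OF K.es_bij[OF that]] by (simp add: out_degree_with_proj)
  \<comment> \<open>Out-degrees are slice lengths, so without isolated vertices no slice is empty,
    as the case \<open>lo = 1\<close> requires.\<close>
  then have "idx u \<noteq> idx (u + 1)" if "\<forall>v\<in>pverts G. out_degree G v \<noteq> 0" "u \<in> {1..n}" for u
    using that assms(2) by force
  then show ?thesis
    using K.kshell_protocol_eq_shell[OF refl assms(2,5)] assms(2,3) by auto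
qed

end
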